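(* Let $I\subset\mathbb{R}$ be an open interval, let $\gamma: I\to \mathbb{R}^2$ be a frontal with Gauss mapping $\nu: I\to S^1$ and let $\lambda: I\to \mathbb{R}_+$ be a positive function (all of class $C^\infty$). Suppose that the circle family $\mathcal{C}_{(\gamma, \lambda)}$ is creative. Then $$\mathcal{D}=E_2\cup \left(\bigcup_{t\in \Sigma(\gamma)}C_{(\gamma(t), \lambda(t))}\right),$$ where $\mathcal{D}$ and $E_2$ are the $\mathcal{D}$ envelope and the $E_2$ envelope created by $\mathcal{C}_{(\gamma,\lambda)}$, and $\Sigma(\gamma)$ is the set of singular points of $\gamma: I\to\mathbb{R}^2$.
   Context: Throughout, $I$ is an open interval of $\mathbb{R}$, all functions and mappings are of class $C^\infty$, $\mathbb{R}_+$ is the set of positive real numbers, $S^1$ is the unit circle in $\mathbb{R}^2$, and $\cdot$ is the standard scalar product on $\mathbb{R}^2$. Frontal: a curve $\gamma: I\to\mathbb{R}^2$ is a frontal if there is a ($C^\infty$) mapping $\nu: I\to S^1$ with $\frac{d\gamma}{dt}(t)\cdot\nu(t)=0$ for every $t\in I$; such a $\nu$ is called a Gauss mapping of $\gamma$. Circle family: for $P\in\mathbb{R}^2$ and $r>0$ let $C_{(P,r)}=\{(x,y)\in\mathbb{R}^2 \mid ((x,y)-P)\cdot((x,y)-P)=r^2\}$, and let $\mathcal{C}_{(\gamma,\lambda)}=\{C_{(\gamma(t),\lambda(t))}\}_{t\in I}$. Creative: $\mathcal{C}_{(\gamma,\lambda)}$ is creative if there exists a ($C^\infty$) mapping $\widetilde{\nu}: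 I\to S^1$ such that $\frac{d\lambda}{dt}(t)=-\beta(t)\left(\widetilde{\nu}(t)\cdot\mu(t)\right)$ for every $t\in I$, where $\mu(t)=J(\nu(t))$, $J$ is the anti-clockwise rotation by $\pi/2$, and $\beta(t)=\frac{d\gamma}{dt}(t)\cdot\mu(t)$. $E_2$ envelope: a ($C^\infty$) mapping $f: I\to\mathbb{R}^2$ is an envelope created by $\mathcal{C}_{(\gamma,\lambda)}$ if for every $t\in I$ both $\frac{df}{dt}(t)\cdot(f(t)-\gamma(t))=0$ and $f(t)\in C_{(\gamma(t),\lambda(t))}$ hold. $E_2\subset\mathbb{R}^2$ is the set consisting of the images of all envelopes created by $\mathcal{C}_{(\gamma,\lambda)}$, i.e. the union of these images. $\mathcal{D}$ envelope: with $F(x,y,t)=\|(x,y)-\gamma(t)\|^2-(\lambda(t))^2$, $$\mathcal{D}=\left\{(x,y)\in\mathbb{R}^2 \mid \exists t\in I \text{ such that } F(x,y,t)=\frac{\partial F}{\partial t}(x,y,t)=0\right\}.$$ Singular point of $\gamma$: a parameter $t\in I$ with $\frac{d\gamma}{dt}(t)=0$. *)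

theory Defs
  imports "HOL-Analysis.Analysis"
begin

text \<open>
  Maps on an open interval are represented by total functions on the reals of which only the
  values on the interval matter: all derivatives below are taken at points of an open set, hence
  depend only on the restriction to that set.
\<close>

definition higher_vderiv :: "nat \<Rightarrow> (real \<Rightarrow> 'a::real_normed_vector) \<Rightarrow> real \<Rightarrow> 'a" where
  "higher_vderiv n f = ((\<lambda>g t. vector_derivative g (at t)) ^^ n) f"

text \<open>Being of class \<open>C\<^sup>\<infinity>\<close>; adequate only for open \<open>I\<close>, because of the two-sided derivatives.\<close>

definition smooth_on :: "real set \<Rightarrow> (real \<Rightarrow> 'a::real_normed_vector) \<Rightarrow> bool" where
  "smooth_on I f \<longleftrightarrow> (\<forall>n. \<forall>t\<in>I. higher_vderiv n f differentiable (at t))"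

definition gauss_mapping :: "real set \<Rightarrow> (real \<Rightarrow> real^2) \<Rightarrow> (real \<Rightarrow> real^2) \<Rightarrow> bool" where
  "gauss_mapping I \<gamma> \<nu> \<longleftrightarrow>
     smooth_on I \<nu> \<and> \<nu> ` I \<subseteq> sphere 0 1 \<and>
     (\<forall>t\<in>I. vector_derivative \<gamma> (at t) \<bullet> \<nu> t = 0)"

definition frontal :: "real set \<Rightarrow> (real \<Rightarrow> real^2) \<Rightarrow> bool" where
  "frontal I \<gamma> \<longleftrightarrow> smooth_on I \<gamma> \<and> (\<exists>\<nu>. gauss_mapping I \<gamma> \<nu>)"

definition rot90 :: "real^2 \<Rightarrow> real^2" where
  "rot90 v = vector [- v $ 2, v $ 1]"

definition beta_fun :: "(real \<Rightarrow> real^2) \<Rightarrow> (real \<Rightarrow> real^2) \<Rightarrow> real \<Rightarrow> real" where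
  "beta_fun \<gamma> \<nu> t = vector_derivative \<gamma> (at t) \<bullet> rot90 (\<nu> t)"

text \<open>Creativity is formulated relative to the chosen Gauss mapping \<open>\<nu>\<close> of \<open>\<gamma>\<close>.\<close>

definition creative ::
  "real set \<Rightarrow> (real \<Rightarrow> real^2) \<Rightarrow> (real \<Rightarrow> real^2) \<Rightarrow> (real \<Rightarrow> real) \<Rightarrow> bool" where
  "creative I \<gamma> \<nu> r \<longleftrightarrow>
     (\<exists>\<nu>'. smooth_on I \<nu>' \<and> \<nu>' ` I \<subseteq> sphere 0 1 \<and>
        (\<forall>t\<in>I. deriv r t = - beta_fun \<gamma> \<nu> t * (\<nu>' t \<bullet> rot90 (\<nu> t))))"

definition circle :: "real^2 \<Rightarrow> real \<Rightarrow> (real^2) set" where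
  "circle P r = {p. (p - P) \<bullet> (p - P) = r\<^sup>2}"

definition envelope ::
  "real set \<Rightarrow> (real \<Rightarrow> real^2) \<Rightarrow> (real \<Rightarrow> real) \<Rightarrow> (real \<Rightarrow> real^2) \<Rightarrow> bool" where
  "envelope I \<gamma> r f \<longleftrightarrow>
     smooth_on I f \<and>
     (\<forall>t\<in>I. vector_derivative f (at t) \<bullet> (f t - \<gamma> t) = 0 \<and> f t \<in> circle (\<gamma> t) (r t))"

definition E2_envelope :: "real set \<Rightarrow> (real \<Rightarrow> real^2) \<Rightarrow> (real \<Rightarrow> real) \<Rightarrow> (real^2) set" where
  "E2_envelope I \<gamma> r = (\<Union>f\<in>{f. envelope I \<gamma> r f}. f ` I)"

definition circle_fun :: "(real \<Rightarrow> real^2) \<Rightarrow> (real \<Rightarrow> real) \<Rightarrow> real^2 \<Rightarrow> real \<Rightarrow> real" where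
  "circle_fun \<gamma> r p t = (norm (p - \<gamma> t))\<^sup>2 - (r t)\<^sup>2"

definition D_envelope :: "real set \<Rightarrow> (real \<Rightarrow> real^2) \<Rightarrow> (real \<Rightarrow> real) \<Rightarrow> (real^2) set" where
  "D_envelope I \<gamma> r =
     {p. \<exists>t\<in>I. circle_fun \<gamma> r p t = 0 \<and> deriv (circle_fun \<gamma> r p) t = 0}"

definition singular_set :: "real set \<Rightarrow> (real \<Rightarrow> real^2) \<Rightarrow> real set" where
  "singular_set I \<gamma> = {t\<in>I. vector_derivative \<gamma> (at t) = 0}"

end

theory Submission
  imports Defs
begin

text \<open>
  Write \<open>\<mu> = rot90 \<nu>\<close>. As \<open>\<gamma>'\<close> is orthogonal to \<open>\<nu>\<close>, it equals \<open>\<beta> \<mu>\<close>, so creativity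
  with direction \<open>w\<close> just says \<open>r' = - \<gamma>' \<bullet> w\<close>, an equation that involves \<open>w\<close> only
  through its \<open>\<mu>\<close>-component wherever \<open>\<beta> \<noteq> 0\<close>.

  A point of the circle at time \<open>t\<close> is \<open>p = \<gamma> t + r t u\<close> with a unit vector \<open>u\<close>, and the
  condition \<open>F\<^sub>t = 0\<close> reads \<open>\<gamma>' \<bullet> (p - \<gamma>) = - r r'\<close>, that is \<open>\<beta> (u \<bullet> \<mu>) = \<beta> (w \<bullet> \<mu>)\<close>.
  If \<open>\<beta> = 0\<close>, then \<open>t\<close> is singular and every \<open>u\<close> is allowed: the whole circle belongs to
  \<open>\<D>\<close>. If \<open>\<beta> \<noteq> 0\<close>, the unit vectors \<open>u\<close> and \<open>w\<close> have the same
  \<open>\<mu>\<close>-component, hence \<open>u\<close> is \<open>w\<close> or its mirror image \<open>w - 2 (w \<bullet> \<nu>) \<nu>\<close> in the line spanned by \<open>\<mu>\<close>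
  (\<open>unit_vectors_eq_or_reflected\<close>). Both choices make sense for all \<open>t\<close> at once, depend
  smoothly on \<open>t\<close> and have the same product with \<open>\<gamma>'\<close>. So both
  \<open>\<gamma> + r w\<close> and \<open>\<gamma> + r (w - 2 (w \<bullet> \<nu>) \<nu>)\<close> are envelopes (\<open>envelope_of_direction\<close>), and one of
  them passes through \<open>p\<close>.

  Conversely, differentiating \<open>|f - \<gamma>|\<^sup>2 = r\<^sup>2\<close> along an envelope \<open>f\<close> and cancelling
  \<open>f' \<bullet> (f - \<gamma>) = 0\<close> gives \<open>F\<^sub>t = 0\<close> at \<open>f t\<close>.

  The analytic input is that smooth maps are closed under sums and bilinear products. This is
  proved for each finite order of differentiability, where the Leibniz rule allows
  induction on the order.
\<close>

section \<open>Smooth maps on an open subset of the line\<close>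

definition smooth_upto :: "nat \<Rightarrow> real set \<Rightarrow> (real \<Rightarrow> 'a::real_normed_vector) \<Rightarrow> bool" where
  "smooth_upto n I f \<longleftrightarrow> (\<forall>k\<le>n. \<forall>t\<in>I. higher_vderiv k f differentiable (at t))"

lemma smooth_on_iff_smooth_upto: "smooth_on I f \<longleftrightarrow> (\<forall>n. smooth_upto n I f)"
  by (auto simp: smooth_on_def smooth_upto_def)

lemma higher_vderiv_0: "higher_vderiv 0 f = f"
  by (simp add: higher_vderiv_def)

lemma higher_vderiv_Suc:
  "higher_vderiv (Suc n) f = higher_vderiv n (\<lambda>t. vector_derivative f (at t))"
  by (simp add: higher_vderiv_def funpow_Suc_right del: funpow.simps)

lemma smooth_upto_0: "smooth_upto 0 I f \<longleftrightarrow> (\<forall>t\<in>I. f differentiable (at t))"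
  by (simp add: smooth_upto_def higher_vderiv_0)

lemma smooth_upto_Suc:
  "smooth_upto (Suc n) I f \<longleftrightarrow>
     (\<forall>t\<in>I. f differentiable (at t)) \<and> smooth_upto n I (\<lambda>t. vector_derivative f (at t))"
proof -
  have "(\<forall>k\<le>Suc n. P k) \<longleftrightarrow> P 0 \<and> (\<forall>k\<le>n. P (Suc k))" for P
    by (metis Suc_le_mono le0 not0_implies_Suc)
  from this[of "\<lambda>k. \<forall>t\<in>I. higher_vderiv k f differentiable (at t)"] show ?thesis
    unfolding smooth_upto_def by (simp add: higher_vderiv_0 higher_vderiv_Suc)
qed

lemma smooth_upto_Suc_imp: "smooth_upto (Suc n) I f \<Longrightarrow> smooth_upto n I f"
  by (simp add: smooth_upto_def)

lemma smooth_upto_imp_differentiable: "smooth_upto n I f \<Longrightarrow> t \<in> I \<Longrightarrow> f differentiable (at t)"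
  by (cases n) (auto simp: smooth_upto_0 smooth_upto_Suc)

lemma vector_derivative_cong_open:
  assumes "open I" and "\<And>t. t \<in> I \<Longrightarrow> f t = g t" and "t \<in> I"
  shows "vector_derivative f (at t) = vector_derivative g (at t)"
proof -
  have "\<forall>\<^sub>F s in nhds t. s \<in> UNIV \<longrightarrow> f s = g s"
    using eventually_nhds_in_open[OF assms(1,3)] by eventually_elim (simp add: assms(2))
  then show ?thesis
    by (intro vector_derivative_cong_eq) (simp_all add: assms)
qed

lemma differentiable_cong_open:
  assumes "open I" and "\<And>t. t \<in> I \<Longrightarrow> f t = g t" and "t \<in> I" and "f differentiable (at t)"
  shows "g differentiable (at t)"
  using assms has_derivative_transform_within_open unfolding differentiable_def by blast

text \<open>
  Derivative formulas hold only at the points of \<open>I\<close>, so an induction on the order has to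
  be able to replace a map by another one that agrees with it on \<open>I\<close>.
\<close>

lemma smooth_upto_cong:
  assumes "open I" and "\<And>t. t \<in> I \<Longrightarrow> f t = g t" and "smooth_upto n I f"
  shows "smooth_upto n I g"
  using assms(2,3)
proof (induction n arbitrary: f g)
  case (0 f g)
  then show ?case
    using differentiable_cong_open[OF assms(1)] unfolding smooth_upto_0 by blast
next
  case (Suc n f g)
  have "g differentiable (at t)" if "t \<in> I" for t
    using differentiable_cong_open[OF assms(1) Suc.prems(1) that] Suc.prems(2) that
    by (simp add: smooth_upto_Suc)
  moreover have "smooth_upto n I (\<lambda>t. vector_derivative g (at t))"
  proof (rule Suc.IH)
    show "vector_derivative f (at t) = vector_derivative g (at t)" if "t \<in> I" for t
      by (rule vector_derivative_cong_open[OF assms(1) Suc.prems(1) that])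
    show "smooth_upto n I (\<lambda>t. vector_derivative f (at t))"
      using Suc.prems(2) by (simp add: smooth_upto_Suc)
  qed
  ultimately show ?case by (simp add: smooth_upto_Suc)
qed

lemma smooth_upto_Suc_of_derivative:
  assumes "open I" and "\<And>t. t \<in> I \<Longrightarrow> (f has_vector_derivative g t) (at t)"
    and "smooth_upto n I g"
  shows "smooth_upto (Suc n) I f"
proof -
  have "smooth_upto n I (\<lambda>t. vector_derivative f (at t))"
    by (rule smooth_upto_cong[OF assms(1) _ assms(3)])
      (simp add: vector_derivative_at[OF assms(2)])
  with assms(2) show ?thesis
    by (auto simp: smooth_upto_Suc intro: differentiableI_vector)
qed

lemma smooth_upto_has_vector_derivative:
  assumes "smooth_upto n I f" and "t \<in> I"
  shows "(f has_vector_derivative vector_derivative f (at t)) (at t)"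
  using smooth_upto_imp_differentiable[OF assms] by (simp add: vector_derivative_works)

lemma smooth_upto_add:
  assumes "open I" and "smooth_upto n I f" and "smooth_upto n I g"
  shows "smooth_upto n I (\<lambda>t. f t + g t)"
  using assms(2,3)
proof (induction n arbitrary: f g)
  case 0
  then show ?case by (simp add: smooth_upto_0)
next
  case (Suc n)
  show ?case
  proof (rule smooth_upto_Suc_of_derivative[OF assms(1)])
    show "((\<lambda>t. f t + g t) has_vector_derivative
        vector_derivative f (at t) + vector_derivative g (at t)) (at t)" if "t \<in> I" for t
      using Suc.prems that
      by (intro has_vector_derivative_add) (auto intro: smooth_upto_has_vector_derivative)
    show "smooth_upto n I (\<lambda>t. vector_derivative f (at t) + vector_derivative g (at t))"
      using Suc.prems by (intro Suc.IH) (auto simp: smooth_upto_Suc)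
  qed
qed

text \<open>
  The two summands of the Leibniz rule are products of maps one order less smooth, so the
  induction hypothesis applies to both.
\<close>

lemma smooth_upto_bilinear:
  assumes "open I" and "bounded_bilinear mul" and "smooth_upto n I f" and "smooth_upto n I g"
  shows "smooth_upto n I (\<lambda>t. mul (f t) (g t))"
  using assms(3,4)
proof (induction n arbitrary: f g)
  case 0
  have "(\<lambda>t. mul (f t) (g t)) differentiable (at t)" if "t \<in> I" for t
    using bounded_bilinear.has_vector_derivative[OF assms(2)
        smooth_upto_has_vector_derivative[OF 0(1) that]
        smooth_upto_has_vector_derivative[OF 0(2) that]]
    by (rule differentiableI_vector)
  then show ?case by (simp add: smooth_upto_0)
next
  case (Suc n)
  let ?f' = "\<lambda>t. vector_derivative f (at t)" and ?g' = "\<lambda>t. vector_derivative g (at t)"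
  show ?case
  proof (rule smooth_upto_Suc_of_derivative[OF assms(1)])
    show "((\<lambda>t. mul (f t) (g t)) has_vector_derivative
        mul (f t) (?g' t) + mul (?f' t) (g t)) (at t)" if "t \<in> I" for t
      using Suc.prems that
      by (intro bounded_bilinear.has_vector_derivative[OF assms(2)])
        (auto intro: smooth_upto_has_vector_derivative)
    show "smooth_upto n I (\<lambda>t. mul (f t) (?g' t) + mul (?f' t) (g t))"
      using Suc.prems Suc.prems[THEN smooth_upto_Suc_imp]
      by (intro smooth_upto_add[OF assms(1)] Suc.IH) (simp_all add: smooth_upto_Suc)
  qed
qed

lemma smooth_upto_const: "open I \<Longrightarrow> smooth_upto n I (\<lambda>t. c)"
  by (induction n arbitrary: c)
    (auto simp: smooth_upto_0 intro: smooth_upto_Suc_of_derivative has_vector_derivative_const)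

lemma smooth_on_add:
  "open I \<Longrightarrow> smooth_on I f \<Longrightarrow> smooth_on I g \<Longrightarrow> smooth_on I (\<lambda>t. f t + g t)"
  by (simp add: smooth_on_iff_smooth_upto smooth_upto_add)

lemma smooth_on_const: "open I \<Longrightarrow> smooth_on I (\<lambda>t. c)"
  by (simp add: smooth_on_iff_smooth_upto smooth_upto_const)

lemma smooth_on_scaleR:
  "open I \<Longrightarrow> smooth_on I f \<Longrightarrow> smooth_on I g \<Longrightarrow> smooth_on I (\<lambda>t. f t *\<^sub>R g t)"
  by (simp add: smooth_on_iff_smooth_upto smooth_upto_bilinear[OF _ bounded_bilinear_scaleR])

lemma smooth_on_inner:
  "open I \<Longrightarrow> smooth_on I f \<Longrightarrow> smooth_on I g \<Longrightarrow> smooth_on I (\<lambda>t. f t \<bullet> g t)"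
  by (simp add: smooth_on_iff_smooth_upto smooth_upto_bilinear[OF _ bounded_bilinear_inner])

lemma smooth_on_has_vector_derivative:
  assumes "smooth_on I f" and "t \<in> I"
  shows "(f has_vector_derivative vector_derivative f (at t)) (at t)"
  using assms smooth_upto_has_vector_derivative smooth_on_iff_smooth_upto by blast

lemma smooth_on_has_real_derivative:
  fixes r :: "real \<Rightarrow> real"
  assumes "smooth_on I r" and "t \<in> I"
  shows "(r has_real_derivative deriv r t) (at t)"
  using smooth_on_has_vector_derivative[OF assms]
  by (metis DERIV_imp_deriv has_real_derivative_iff_has_vector_derivative)

section \<open>Orthonormal frames of the plane\<close>

lemma rot90_frame_expansion:
  assumes "norm n = 1"
  shows "a = (a \<bullet> n) *\<^sub>R n + (a \<bullet> rot90 n) *\<^sub>R rot90 n"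
proof -
  have n: "(n $ 1)\<^sup>2 + (n $ 2)\<^sup>2 = 1"
    using assms by (simp add: norm_eq_1 inner_vec_def sum_2 power2_eq_square)
  have 1: "a $ 1 = a $ 1 * ((n $ 1)\<^sup>2 + (n $ 2)\<^sup>2)" and 2: "a $ 2 = a $ 2 * ((n $ 1)\<^sup>2 + (n $ 2)\<^sup>2)"
    by (simp_all add: n)
  show ?thesis
    unfolding vec_eq_iff forall_2 using 1 2
    by (simp add: rot90_def inner_vec_def sum_2 power2_eq_square algebra_simps)
qed

lemma rot90_frame_inner:
  assumes "norm n = 1"
  shows "a \<bullet> b = (a \<bullet> n) * (b \<bullet> n) + (a \<bullet> rot90 n) * (b \<bullet> rot90 n)"
proof -
  have "a \<bullet> b = a \<bullet> ((b \<bullet> n) *\<^sub>R n + (b \<bullet> rot90 n) *\<^sub>R rot90 n)"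
    using rot90_frame_expansion[OF assms, of b] by simp
  then show ?thesis by (simp add: inner_add_right mult.commute)
qed

lemma norm_reflection:
  fixes n v :: "'a::real_inner"
  assumes "norm n = 1"
  shows "norm (v - (2 * (v \<bullet> n)) *\<^sub>R n) = norm v"
proof -
  have "n \<bullet> n = 1"
    using assms by (simp add: norm_eq_1)
  then have "(v - (2 * (v \<bullet> n)) *\<^sub>R n) \<bullet> (v - (2 * (v \<bullet> n)) *\<^sub>R n) = v \<bullet> v"
    by (simp add: inner_diff inner_commute algebra_simps)
  then show ?thesis by (simp add: norm_eq)
qed

text \<open>
  Two unit vectors with the same \<open>rot90 n\<close>-component have \<open>n\<close>-components with the same
  square; equal signs give equal vectors, opposite signs mirror images.
\<close>

lemma unit_vectors_eq_or_reflected: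
  assumes "norm n = 1" and "norm u = 1" and "norm v = 1" and "u \<bullet> rot90 n = v \<bullet> rot90 n"
  shows "u = v \<or> u = v - (2 * (v \<bullet> n)) *\<^sub>R n"
proof -
  note u = rot90_frame_expansion[OF assms(1), of u]
  note v = rot90_frame_expansion[OF assms(1), of v]
  have "(u \<bullet> n)\<^sup>2 = (v \<bullet> n)\<^sup>2"
    using rot90_frame_inner[OF assms(1), of u u] rot90_frame_inner[OF assms(1), of v v] assms
    by (simp add: norm_eq_1 power2_eq_square)
  then consider "u \<bullet> n = v \<bullet> n" | "u \<bullet> n = - (v \<bullet> n)"
    by (auto simp: power2_eq_iff)
  then show ?thesis
  proof cases
    case 1
    then have "u = v" using u v assms(4) by metis
    then show ?thesis ..
  next
    case 2
    have "u = (- (v \<bullet> n)) *\<^sub>R n + (v \<bullet> rot90 n) *\<^sub>R rot90 n"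
      using u 2 assms(4) by metis
    also have "\<dots> = ((v \<bullet> n) *\<^sub>R n + (v \<bullet> rot90 n) *\<^sub>R rot90 n) - (2 * (v \<bullet> n)) *\<^sub>R n"
      by (simp only: mult_2 scaleR_add_left scaleR_minus_left) simp
    also have "\<dots> = v - (2 * (v \<bullet> n)) *\<^sub>R n"
      using v by simp
    finally show ?thesis ..
  qed
qed

section \<open>Envelopes of circle families\<close>

text \<open>A velocity orthogonal to \<open>\<nu> t\<close> is \<open>\<beta> t\<close> times \<open>rot90 (\<nu> t)\<close>.\<close>

lemma gauss_mapping_velocity_inner:
  assumes "gauss_mapping I \<gamma> \<nu>" and "t \<in> I"
  shows "vector_derivative \<gamma> (at t) \<bullet> v = beta_fun \<gamma> \<nu> t * (v \<bullet> rot90 (\<nu> t))"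
proof -
  have "norm (\<nu> t) = 1" and "vector_derivative \<gamma> (at t) \<bullet> \<nu> t = 0"
    using assms by (auto simp: gauss_mapping_def)
  from rot90_frame_inner[OF this(1), of "vector_derivative \<gamma> (at t)" v] this(2)
  show ?thesis by (simp add: beta_fun_def)
qed

lemma deriv_circle_fun:
  assumes "(\<gamma> has_vector_derivative d) (at t)" and "(r has_real_derivative s) (at t)"
  shows "deriv (circle_fun \<gamma> r p) t = - 2 * (d \<bullet> (p - \<gamma> t) + r t * s)"
proof -
  have "((\<lambda>x. p - \<gamma> x) has_vector_derivative - d) (at t)"
    by (rule derivative_eq_intros assms refl | simp)+
  from bounded_bilinear.has_vector_derivative[OF bounded_bilinear_inner this this]
  have "((\<lambda>x. (p - \<gamma> x) \<bullet> (p - \<gamma> x)) has_real_derivative - 2 * (d \<bullet> (p - \<gamma> t))) (at t)"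
    by (simp add: has_real_derivative_iff_has_vector_derivative inner_commute)
  moreover have "((\<lambda>x. (r x)\<^sup>2) has_real_derivative 2 * (r t * s)) (at t)"
    by (rule derivative_eq_intros assms refl | simp)+
  ultimately have "((\<lambda>x. (p - \<gamma> x) \<bullet> (p - \<gamma> x) - (r x)\<^sup>2)
      has_real_derivative - 2 * (d \<bullet> (p - \<gamma> t)) - 2 * (r t * s)) (at t)"
    by (rule DERIV_diff)
  then show ?thesis
    unfolding circle_fun_def power2_norm_eq_inner by (simp add: DERIV_imp_deriv)
qed

text \<open>
  The defining condition \<open>f' \<bullet> (f - \<gamma>) = 0\<close> and, for a curve running on the circles, the
  derivative of \<open>|f - \<gamma>|\<^sup>2 = r\<^sup>2\<close> together eliminate \<open>f'\<close>: an envelope is recognised by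
  its position alone.
\<close>

lemma envelope_condition_iff:
  assumes "open I" and "t \<in> I" and "\<And>s. s \<in> I \<Longrightarrow> f s \<in> circle (\<gamma> s) (r s)"
    and f: "(f has_vector_derivative e) (at t)"
    and \<gamma>: "(\<gamma> has_vector_derivative d) (at t)" and r: "(r has_real_derivative s) (at t)"
  shows "e \<bullet> (f t - \<gamma> t) = 0 \<longleftrightarrow> d \<bullet> (f t - \<gamma> t) + r t * s = 0"
proof -
  have "((\<lambda>x. f x - \<gamma> x) has_vector_derivative e - d) (at t)"
    using f \<gamma> by (rule has_vector_derivative_diff)
  from bounded_bilinear.has_vector_derivative[OF bounded_bilinear_inner this this]
  have 1: "((\<lambda>x. (f x - \<gamma> x) \<bullet> (f x - \<gamma> x)) has_real_derivative 2 * ((e - d) \<bullet> (f t - \<gamma> t))) (at t)"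
    by (simp add: has_real_derivative_iff_has_vector_derivative inner_commute)
  have "((\<lambda>x. (r x)\<^sup>2) has_real_derivative 2 * (r t * s)) (at t)"
    by (rule derivative_eq_intros r refl | simp)+
  moreover have "(r x)\<^sup>2 = (f x - \<gamma> x) \<bullet> (f x - \<gamma> x)" if "x \<in> I" for x
    using assms(3)[OF that] by (simp add: circle_def)
  ultimately have
    "((\<lambda>x. (f x - \<gamma> x) \<bullet> (f x - \<gamma> x)) has_real_derivative 2 * (r t * s)) (at t)"
    by (rule has_field_derivative_transform_within_open[OF _ assms(1,2)])
  with 1 have "(e - d) \<bullet> (f t - \<gamma> t) = r t * s"
    using DERIV_unique by force
  then show ?thesis by (auto simp: inner_diff_left)
qed

text \<open>
  For \<open>f = \<gamma> + r w\<close> one has \<open>f - \<gamma> = r w\<close>, so the condition of \<open>envelope_condition_iff\<close> is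
  the hypothesis on \<open>r'\<close> multiplied by \<open>r\<close>.
\<close>

lemma envelope_of_direction:
  assumes I: "open I" and \<gamma>: "smooth_on I \<gamma>" and r: "smooth_on I r" and w: "smooth_on I w"
    and unit: "\<And>t. t \<in> I \<Longrightarrow> norm (w t) = 1"
    and rate: "\<And>t. t \<in> I \<Longrightarrow> deriv r t = - (vector_derivative \<gamma> (at t) \<bullet> w t)"
  shows "envelope I \<gamma> r (\<lambda>t. \<gamma> t + r t *\<^sub>R w t)"
proof -
  let ?f = "\<lambda>t. \<gamma> t + r t *\<^sub>R w t"
  have smooth: "smooth_on I ?f"
    by (intro smooth_on_add smooth_on_scaleR I \<gamma> r w)
  have circle: "?f t \<in> circle (\<gamma> t) (r t)" if "t \<in> I" for t
    using unit[OF that] by (simp add: circle_def norm_eq_1 power2_eq_square)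
  have "vector_derivative ?f (at t) \<bullet> (?f t - \<gamma> t) = 0" if "t \<in> I" for t
    using envelope_condition_iff[where f = ?f, OF I that circle
        smooth_on_has_vector_derivative[OF smooth that]
        smooth_on_has_vector_derivative[OF \<gamma> that] smooth_on_has_real_derivative[OF r that]]
    by (simp add: rate[OF that])
  with smooth circle show ?thesis by (simp add: envelope_def)
qed

theorem theorem3:
  fixes I :: "real set" and \<gamma> \<nu> :: "real \<Rightarrow> real^2" and r :: "real \<Rightarrow> real"
  assumes "open I" and "is_interval I"
    and "frontal I \<gamma>" and "gauss_mapping I \<gamma> \<nu>"
    and "smooth_on I r" and "\<And>t. t \<in> I \<Longrightarrow> r t > 0"
    and "creative I \<gamma> \<nu> r"
  shows "D_envelope I \<gamma> r =
    E2_envelope I \<gamma> r \<union> (\<Union>t\<in>singular_set I \<gamma>. circle (\<gamma> t) (r t))"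
proof -
  let ?d = "\<lambda>t. vector_derivative \<gamma> (at t)"
  have \<gamma>: "smooth_on I \<gamma>"
    using assms(3) by (simp add: frontal_def)
  have \<nu>: "smooth_on I \<nu>" and \<nu>_unit: "\<And>t. t \<in> I \<Longrightarrow> norm (\<nu> t) = 1"
    and \<nu>_orth: "\<And>t. t \<in> I \<Longrightarrow> ?d t \<bullet> \<nu> t = 0"
    using assms(4) by (auto simp: gauss_mapping_def)
  note velocity = gauss_mapping_velocity_inner[OF assms(4)]
  obtain w where w: "smooth_on I w" and w_unit: "\<And>t. t \<in> I \<Longrightarrow> norm (w t) = 1"
    and creative: "\<And>t. t \<in> I \<Longrightarrow> deriv r t = - beta_fun \<gamma> \<nu> t * (w t \<bullet> rot90 (\<nu> t))"
    using assms(7) unfolding creative_def by fastforce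
  have rate: "deriv r t = - (?d t \<bullet> w t)" if "t \<in> I" for t
    by (simp add: creative[OF that] velocity[OF that])
  have D_iff: "p \<in> D_envelope I \<gamma> r \<longleftrightarrow>
      (\<exists>t\<in>I. p \<in> circle (\<gamma> t) (r t) \<and> ?d t \<bullet> (p - \<gamma> t) + r t * deriv r t = 0)" for p
    using deriv_circle_fun[OF smooth_on_has_vector_derivative[OF \<gamma>]
        smooth_on_has_real_derivative[OF assms(5)]]
    by (auto simp: D_envelope_def circle_fun_def circle_def power2_norm_eq_inner)

  define w' where "w' t = w t - (2 * (w t \<bullet> \<nu> t)) *\<^sub>R \<nu> t" for t
  have w'_smooth: "smooth_on I w'"
  proof -
    \<comment> \<open>The reflection written with sums and bilinear products only; the scalar \<open>- 2\<close> is a constant map.\<close>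
    have "smooth_on I (\<lambda>t. w t + ((w t \<bullet> \<nu> t) *\<^sub>R (- 2)) *\<^sub>R \<nu> t)"
      by (intro smooth_on_add smooth_on_scaleR smooth_on_inner smooth_on_const assms(1) w \<nu>)
    also have "(\<lambda>t. w t + ((w t \<bullet> \<nu> t) *\<^sub>R (- 2)) *\<^sub>R \<nu> t) = w'"
      by (simp add: w'_def fun_eq_iff mult.commute)
    finally show ?thesis .
  qed
  have envelope_w: "envelope I \<gamma> r (\<lambda>t. \<gamma> t + r t *\<^sub>R w t)"
    by (rule envelope_of_direction[OF assms(1) \<gamma> assms(5) w w_unit rate])
  have envelope_w': "envelope I \<gamma> r (\<lambda>t. \<gamma> t + r t *\<^sub>R w' t)"
  proof (rule envelope_of_direction[OF assms(1) \<gamma> assms(5) w'_smooth])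
    show "norm (w' t) = 1" if "t \<in> I" for t
      using that by (simp add: w'_def norm_reflection \<nu>_unit w_unit)
    show "deriv r t = - (?d t \<bullet> w' t)" if "t \<in> I" for t
      using that by (simp add: w'_def inner_diff_right \<nu>_orth rate)
  qed

  show ?thesis
  proof (intro equalityI subsetI)
    fix p assume "p \<in> D_envelope I \<gamma> r"
    then obtain t where t: "t \<in> I" and p: "p \<in> circle (\<gamma> t) (r t)"
      and Ft: "?d t \<bullet> (p - \<gamma> t) + r t * deriv r t = 0"
      by (auto simp: D_iff)
    show "p \<in> E2_envelope I \<gamma> r \<union> (\<Union>t\<in>singular_set I \<gamma>. circle (\<gamma> t) (r t))"
    proof (cases "?d t = 0")
      case True
      with t p show ?thesis by (auto simp: singular_set_def)
    next
      case False
      have \<beta>: "beta_fun \<gamma> \<nu> t \<noteq> 0"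
        using velocity[OF t, of "?d t"] False by auto
      have rt: "r t > 0" by (rule assms(6)[OF t])
      define u where "u = (1 / r t) *\<^sub>R (p - \<gamma> t)"
      have p_eq: "p = \<gamma> t + r t *\<^sub>R u"
        using rt by (simp add: u_def)
      have "norm u = 1"
      proof -
        have "(norm (p - \<gamma> t))\<^sup>2 = (r t)\<^sup>2"
          using p by (simp add: circle_def power2_norm_eq_inner)
        then show ?thesis using rt by (simp add: u_def power2_eq_iff_nonneg)
      qed
      moreover have "u \<bullet> rot90 (\<nu> t) = w t \<bullet> rot90 (\<nu> t)"
      proof -
        have "r t * (?d t \<bullet> u) = r t * (?d t \<bullet> w t)"
          using Ft by (simp add: p_eq rate[OF t])
        then show ?thesis using rt \<beta> by (simp add: velocity[OF t])
      qed
      ultimately have "u = w t \<or> u = w' t"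
        unfolding w'_def by (intro unit_vectors_eq_or_reflected \<nu>_unit w_unit t)
      with t p_eq envelope_w envelope_w' have "p \<in> E2_envelope I \<gamma> r"
        unfolding E2_envelope_def by blast
      then show ?thesis ..
    qed
  next
    fix p assume "p \<in> E2_envelope I \<gamma> r \<union> (\<Union>t\<in>singular_set I \<gamma>. circle (\<gamma> t) (r t))"
    then consider f t where "envelope I \<gamma> r f" "t \<in> I" "p = f t"
      | t where "t \<in> I" "?d t = 0" "p \<in> circle (\<gamma> t) (r t)"
      by (auto simp: E2_envelope_def singular_set_def)
    then show "p \<in> D_envelope I \<gamma> r"
    proof cases
      case (1 f t)
      then have f: "smooth_on I f" "\<And>s. s \<in> I \<Longrightarrow> f s \<in> circle (\<gamma> s) (r s)"
        and "vector_derivative f (at t) \<bullet> (f t - \<gamma> t) = 0"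
        by (auto simp: envelope_def)
      then have "?d t \<bullet> (f t - \<gamma> t) + r t * deriv r t = 0"
        using envelope_condition_iff[where f = f, OF assms(1) 1(2) f(2)
            smooth_on_has_vector_derivative[OF f(1) 1(2)]
            smooth_on_has_vector_derivative[OF \<gamma> 1(2)]
            smooth_on_has_real_derivative[OF assms(5) 1(2)]]
        by simp
      with 1 f show ?thesis by (auto simp: D_iff)
    next
      case (2 t)
      \<comment> \<open>By creativity the radius is stationary as well at a singular point of the centre curve.\<close>
      then have "deriv r t = 0" by (simp add: rate)
      with 2 show ?thesis by (auto simp: D_iff)
    qed
  qed
qed

end
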